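(* For every $n\ge 1$, $\lambda\in\mathbb{R}_+$, $c\in\mathbb{R}$ such that $\psi^{(a)}$ has no points of increase in the interval $(c,c+1)$, and $a>0$, the Sobolev-type Charlier polynomials $\{Q_n^\lambda\}_{n\ge0}$ satisfy the second order difference equation $$\Delta^{2}Q_{n}^{\lambda}(x)+\mathcal{R}(x;n)\,\Delta Q_{n}^{\lambda}(x)+\mathcal{S}(x;n)\,Q_{n}^{\lambda}(x)=0,$$ with rational coefficients $$\mathcal{R}(x;n)=\frac{[\Theta_1(x;n)-1]\,\Delta\Xi_1(x;n)}{\Xi_1(x;n)}-\Delta\Xi_2(x;n)+\Theta_1(x;n)-\Xi_2(x;n),$$ $$\mathcal{S}(x;n)=\Theta_2(x;n)\left[\Xi_1(x;n)+\Delta\Xi_1(x;n)\right]-\Delta\Xi_2(x;n)-\Theta_1(x;n)\Xi_2(x;n)-\frac{\Xi_2(x;n)\,[\Theta_1(x;n)-1]\,\Delta\Xi_1(x;n)}{\Xi_1(x;n)}.$$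
   Context: Let $a>0$ and let $\psi^{(a)}$ be the Poisson distribution, the discrete measure with mass $e^{-a}a^{x}/x!$ at $x=0,1,2,\ldots$. "No points of increase in $(c,c+1)$" means that $(c,c+1)$ contains no nonnegative integer. $\Delta f(x)=f(x+1)-f(x)$, always acting on the variable $x$; $\Delta^2=\Delta\circ\Delta$. $\{C_n^{(a)}\}_{n\ge0}$ are the monic Charlier polynomials, orthogonal with respect to $\langle p,q\rangle=\int_0^\infty pq\,d\psi^{(a)}$; $C_{-1}^{(a)}=0$, $C_0^{(a)}=1$, $C_{n+1}^{(a)}(x)=(x-n-a)C_n^{(a)}(x)-na\,C_{n-1}^{(a)}(x)$, $\|C_n^{(a)}\|^2=n!a^n$. $\{Q_n^\lambda\}_{n\ge0}$ is the sequence of monic polynomials ($\deg Q_n^\lambda=n$) orthogonal with respect to $\langle p,q\rangle_\lambda=\int_0^\infty pq\,d\psi^{(a)}+\lambda\,\Delta p(c)\,\Delta q(c)$. Put $$A_{1}(x;n)=1-\lambda \frac{\Delta Q_{n}^{\lambda }(c)}{\|C_{n-1}^{(a)}\|^{2}}\,\frac{C_{n-1}^{(a)}(c)+(x-c)\Delta C_{n-1}^{(a)}(c)}{(x-c)(x-c-1)},\qquad B_{1}(x;n)=\lambda \frac{\Delta Q_{n}^{\lambda }(c)}{\|C_{n-1}^{(a)}\|^{2}}\,\frac{C_{n}^{(a)}(c)+(x-c)\Delta C_{n}^{(a)}(c)}{(x-c)(x-c-1)},$$ $$C_1(x;n)=A_1(x+1;n)-A_1(x;n)-\tfrac1a B_1(x+1;n),$$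 $$D_1(x;n)=nA_1(x+1;n)-B_1(x;n)+\tfrac{x-n+1}{a}B_1(x+1;n),$$ $$A_2(x;n)=\frac{-B_1(x;n-1)}{a(n-1)},\qquad B_2(x;n)=A_1(x;n-1)+\frac{x-n-a+1}{a(n-1)}B_1(x;n-1),$$ $$C_2(x;n)=\frac{aB_1(x;n-1)-a(n-1)A_1(x+1;n-1)-(x-n+2)B_1(x+1;n-1)}{a^2(n-1)},$$ $$D_2(x;n)=\frac{a(n-1)(1-n+x)A_1(x+1;n-1)+a(-1+a+n-x)B_1(x;n-1)}{a^2(n-1)}-A_1(x;n-1)+\frac{[(n-x-2)(n-x-1)-a(1+x)]B_1(x+1;n-1)}{a^2(n-1)},$$ $$\Lambda(x;n)=A_1(x;n)B_2(x;n)-B_1(x;n)A_2(x;n),$$ and for $k=1,2$ $$\Xi_k(x;n)=\frac{C_1(x;n)B_k(x;n)-A_k(x;n)D_1(x;n)}{\Lambda(x;n)},\qquad \Theta_k(x;n)=\frac{C_2(x;n)B_k(x;n)-A_k(x;n)D_2(x;n)}{\Lambda(x;n)}.$$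
   Formalization: For n=1 the printed A_2, B_2, C_2, D_2 are undefined (division by n-1=0 and by the norm of C_{-1}=0); there they are taken as the values after cancelling the removable factor: A_2=0, B_2=1, C_2=-1/a, D_2=x/a-1. *)

theory Defs
  imports "HOL-Probability.Probability" "HOL-Computational_Algebra.Polynomial"
begin

definition Delta :: "(real \<Rightarrow> real) \<Rightarrow> real \<Rightarrow> real" where
  "Delta f x = f (x + 1) - f x"

definition psi :: "real \<Rightarrow> real pmf" where
  "psi a = map_pmf real (poisson_pmf a)"

definition poisson_inner :: "real \<Rightarrow> real poly \<Rightarrow> real poly \<Rightarrow> real" where
  "poisson_inner a p q = (\<integral>x. poly p x * poly q x \<partial>measure_pmf (psi a))"

definition sobolev_inner ::
    "real \<Rightarrow> real \<Rightarrow> real \<Rightarrow> real poly \<Rightarrow> real poly \<Rightarrow> real" where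
  "sobolev_inner a lam c p q =
     poisson_inner a p q + lam * Delta (poly p) c * Delta (poly q) c"

text \<open>The second equation is the recurrence at index 0, where the term with index -1 vanishes.\<close>

fun charlier :: "real \<Rightarrow> nat \<Rightarrow> real poly" where
  "charlier a 0 = 1"
| "charlier a (Suc 0) = [:- a, 1:]"
| "charlier a (Suc (Suc n)) =
     [:- real (Suc n) - a, 1:] * charlier a (Suc n) - smult (real (Suc n) * a) (charlier a n)"

definition charlier_norm_sq :: "real \<Rightarrow> nat \<Rightarrow> real" where
  "charlier_norm_sq a n = poisson_inner a (charlier a n) (charlier a n)"

definition sobolev_charlier :: "real \<Rightarrow> real \<Rightarrow> real \<Rightarrow> (nat \<Rightarrow> real poly) \<Rightarrow> bool" where
  "sobolev_charlier a lam c Q \<longleftrightarrow>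
     (\<forall>n. degree (Q n) = n \<and> lead_coeff (Q n) = 1) \<and>
     (\<forall>m n. m \<noteq> n \<longrightarrow> sobolev_inner a lam c (Q m) (Q n) = 0)"

definition rational_on :: "real set \<Rightarrow> (real \<Rightarrow> real) \<Rightarrow> bool" where
  "rational_on X f \<longleftrightarrow>
     (\<exists>p q :: real poly. \<forall>x\<in>X. poly q x \<noteq> 0 \<and> f x = poly p x / poly q x)"

text \<open>All coefficient functions below are used for \<open>n \<ge> 1\<close> only; \<open>coefA1\<close> and \<open>coefB1\<close> are
  never evaluated at index 0, so the truncated subtraction \<open>n - 1\<close> is harmless.\<close>

definition coefA1 ::
    "real \<Rightarrow> real \<Rightarrow> real \<Rightarrow> (nat \<Rightarrow> real poly) \<Rightarrow> nat \<Rightarrow> real \<Rightarrow> real" where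
  "coefA1 a lam c Q n x =
     1 - lam * (Delta (poly (Q n)) c / charlier_norm_sq a (n - 1)) *
       ((poly (charlier a (n - 1)) c + (x - c) * Delta (poly (charlier a (n - 1))) c)
         / ((x - c) * (x - c - 1)))"

definition coefB1 ::
    "real \<Rightarrow> real \<Rightarrow> real \<Rightarrow> (nat \<Rightarrow> real poly) \<Rightarrow> nat \<Rightarrow> real \<Rightarrow> real" where
  "coefB1 a lam c Q n x =
     lam * (Delta (poly (Q n)) c / charlier_norm_sq a (n - 1)) *
       ((poly (charlier a n) c + (x - c) * Delta (poly (charlier a n)) c)
         / ((x - c) * (x - c - 1)))"

definition coefC1 ::
    "real \<Rightarrow> real \<Rightarrow> real \<Rightarrow> (nat \<Rightarrow> real poly) \<Rightarrow> nat \<Rightarrow> real \<Rightarrow> real" where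
  "coefC1 a lam c Q n x =
     coefA1 a lam c Q n (x + 1) - coefA1 a lam c Q n x - 1 / a * coefB1 a lam c Q n (x + 1)"

definition coefD1 ::
    "real \<Rightarrow> real \<Rightarrow> real \<Rightarrow> (nat \<Rightarrow> real poly) \<Rightarrow> nat \<Rightarrow> real \<Rightarrow> real" where
  "coefD1 a lam c Q n x =
     real n * coefA1 a lam c Q n (x + 1) - coefB1 a lam c Q n x
     + (x - real n + 1) / a * coefB1 a lam c Q n (x + 1)"

text \<open>For \<open>n = 1\<close> the general formulas for the next four functions have a vanishing factor
  \<open>n - 1\<close> in the denominator.  It is removable: since
  \<open>a (n - 1) \<parallel>C\<^bsub>n-2\<^esub>\<parallel>\<^sup>2 = \<parallel>C\<^bsub>n-1\<^esub>\<parallel>\<^sup>2\<close>, the quotient \<open>B1(x; n-1) / (a (n - 1))\<close> is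
  \<open>\<lambda> \<Delta>Q\<^bsub>n-1\<^esub>(c) / \<parallel>C\<^bsub>n-1\<^esub>\<parallel>\<^sup>2\<close> times a rational function that is regular at \<open>n = 1\<close>,
  and \<open>\<Delta>Q\<^sub>0 = 0\<close>; likewise \<open>A1(x; 0) = 1\<close>, because \<open>C\<^bsub>-1\<^esub> = 0\<close>; in the terms with
  \<open>A1(x + 1; n-1)\<close> the factor \<open>n - 1\<close> cancels.  The values at \<open>n = 1\<close> are those obtained after
  this cancellation (they express \<open>Q\<^sub>0 = 0 * C\<^sub>1 + 1 * C\<^sub>0\<close> and
  \<open>\<Delta>Q\<^sub>0 = -1/a * C\<^sub>1 + (x/a - 1) * C\<^sub>0 = 0\<close>).\<close>

definition coefA2 ::
    "real \<Rightarrow> real \<Rightarrow> real \<Rightarrow> (nat \<Rightarrow> real poly) \<Rightarrow> nat \<Rightarrow> real \<Rightarrow> real" where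
  "coefA2 a lam c Q n x =
     (if n = 1 then 0
      else - coefB1 a lam c Q (n - 1) x / (a * (real n - 1)))"

definition coefB2 ::
    "real \<Rightarrow> real \<Rightarrow> real \<Rightarrow> (nat \<Rightarrow> real poly) \<Rightarrow> nat \<Rightarrow> real \<Rightarrow> real" where
  "coefB2 a lam c Q n x =
     (if n = 1 then 1
      else coefA1 a lam c Q (n - 1) x
        + (x - real n - a + 1) / (a * (real n - 1)) * coefB1 a lam c Q (n - 1) x)"

definition coefC2 ::
    "real \<Rightarrow> real \<Rightarrow> real \<Rightarrow> (nat \<Rightarrow> real poly) \<Rightarrow> nat \<Rightarrow> real \<Rightarrow> real" where
  "coefC2 a lam c Q n x =
     (if n = 1 then - 1 / a
      else (a * coefB1 a lam c Q (n - 1) x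
            - a * (real n - 1) * coefA1 a lam c Q (n - 1) (x + 1)
            - (x - real n + 2) * coefB1 a lam c Q (n - 1) (x + 1))
           / (a\<^sup>2 * (real n - 1)))"

definition coefD2 ::
    "real \<Rightarrow> real \<Rightarrow> real \<Rightarrow> (nat \<Rightarrow> real poly) \<Rightarrow> nat \<Rightarrow> real \<Rightarrow> real" where
  "coefD2 a lam c Q n x =
     (if n = 1 then x / a - 1
      else (a * (real n - 1) * (1 - real n + x) * coefA1 a lam c Q (n - 1) (x + 1)
            + a * (- 1 + a + real n - x) * coefB1 a lam c Q (n - 1) x)
           / (a\<^sup>2 * (real n - 1))
         - coefA1 a lam c Q (n - 1) x
         + ((real n - x - 2) * (real n - x - 1) - a * (1 + x))
           * coefB1 a lam c Q (n - 1) (x + 1) / (a\<^sup>2 * (real n - 1)))"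

definition Lam ::
    "real \<Rightarrow> real \<Rightarrow> real \<Rightarrow> (nat \<Rightarrow> real poly) \<Rightarrow> nat \<Rightarrow> real \<Rightarrow> real" where
  "Lam a lam c Q n x =
     coefA1 a lam c Q n x * coefB2 a lam c Q n x - coefB1 a lam c Q n x * coefA2 a lam c Q n x"

definition Xi1 ::
    "real \<Rightarrow> real \<Rightarrow> real \<Rightarrow> (nat \<Rightarrow> real poly) \<Rightarrow> nat \<Rightarrow> real \<Rightarrow> real" where
  "Xi1 a lam c Q n x =
     (coefC1 a lam c Q n x * coefB1 a lam c Q n x - coefA1 a lam c Q n x * coefD1 a lam c Q n x)
     / Lam a lam c Q n x"

definition Xi2 ::
    "real \<Rightarrow> real \<Rightarrow> real \<Rightarrow> (nat \<Rightarrow> real poly) \<Rightarrow> nat \<Rightarrow> real \<Rightarrow> real" where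
  "Xi2 a lam c Q n x =
     (coefC1 a lam c Q n x * coefB2 a lam c Q n x - coefA2 a lam c Q n x * coefD1 a lam c Q n x)
     / Lam a lam c Q n x"

definition Theta1 ::
    "real \<Rightarrow> real \<Rightarrow> real \<Rightarrow> (nat \<Rightarrow> real poly) \<Rightarrow> nat \<Rightarrow> real \<Rightarrow> real" where
  "Theta1 a lam c Q n x =
     (coefC2 a lam c Q n x * coefB1 a lam c Q n x - coefA1 a lam c Q n x * coefD2 a lam c Q n x)
     / Lam a lam c Q n x"

definition Theta2 ::
    "real \<Rightarrow> real \<Rightarrow> real \<Rightarrow> (nat \<Rightarrow> real poly) \<Rightarrow> nat \<Rightarrow> real \<Rightarrow> real" where
  "Theta2 a lam c Q n x =
     (coefC2 a lam c Q n x * coefB2 a lam c Q n x - coefA2 a lam c Q n x * coefD2 a lam c Q n x)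
     / Lam a lam c Q n x"

definition coefR ::
    "real \<Rightarrow> real \<Rightarrow> real \<Rightarrow> (nat \<Rightarrow> real poly) \<Rightarrow> nat \<Rightarrow> real \<Rightarrow> real" where
  "coefR a lam c Q n x =
     (Theta1 a lam c Q n x - 1) * Delta (Xi1 a lam c Q n) x / Xi1 a lam c Q n x
     - Delta (Xi2 a lam c Q n) x + Theta1 a lam c Q n x - Xi2 a lam c Q n x"

definition coefS ::
    "real \<Rightarrow> real \<Rightarrow> real \<Rightarrow> (nat \<Rightarrow> real poly) \<Rightarrow> nat \<Rightarrow> real \<Rightarrow> real" where
  "coefS a lam c Q n x =
     Theta2 a lam c Q n x * (Xi1 a lam c Q n x + Delta (Xi1 a lam c Q n) x)
     - Delta (Xi2 a lam c Q n) x - Theta1 a lam c Q n x * Xi2 a lam c Q n x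
     - Xi2 a lam c Q n x * (Theta1 a lam c Q n x - 1) * Delta (Xi1 a lam c Q n) x
       / Xi1 a lam c Q n x"

text \<open>The points at which no denominator occurring in \<open>coefR\<close> and \<open>coefS\<close> vanishes: these
  evaluate \<open>coefA1\<close> and \<open>coefB1\<close> at \<open>x\<close>, \<open>x + 1\<close> and \<open>x + 2\<close>, and divide by \<open>Lam\<close> at \<open>x\<close> and
  \<open>x + 1\<close> and by \<open>Xi1\<close> at \<open>x\<close>.\<close>

definition regular_points ::
    "real \<Rightarrow> real \<Rightarrow> real \<Rightarrow> (nat \<Rightarrow> real poly) \<Rightarrow> nat \<Rightarrow> real set" where
  "regular_points a lam c Q n =
     {x. (\<forall>y\<in>{x, x + 1, x + 2}. (y - c) * (y - c - 1) \<noteq> 0) \<and>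
         Lam a lam c Q n x \<noteq> 0 \<and> Lam a lam c Q n (x + 1) \<noteq> 0 \<and> Xi1 a lam c Q n x \<noteq> 0}"

end

theory Submission
  imports Defs "HOL-Real_Asymp.Real_Asymp"
begin

text \<open>Expanding \<open>Q\<^sub>n\<close> in Charlier polynomials and summing the kernel by Christoffel--Darboux gives
  \<open>Q\<^sub>n = A1 C\<^sub>n + B1 C\<^bsub>n-1\<^esub>\<close>; the three-term recurrence and \<open>\<Delta>C\<^sub>n = n C\<^bsub>n-1\<^esub>\<close> turn this into
  similar formulas for \<open>Q\<^bsub>n-1\<^esub>\<close>, \<open>\<Delta>Q\<^sub>n\<close> and \<open>\<Delta>Q\<^bsub>n-1\<^esub>\<close>.  Eliminating \<open>C\<^sub>n\<close> and \<open>C\<^bsub>n-1\<^esub>\<close> yields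
  \<open>\<Delta>Q\<^sub>n = \<Xi>\<^sub>2 Q\<^sub>n - \<Xi>\<^sub>1 Q\<^bsub>n-1\<^esub>\<close> and \<open>\<Delta>Q\<^bsub>n-1\<^esub> = \<Theta>\<^sub>2 Q\<^sub>n - \<Theta>\<^sub>1 Q\<^bsub>n-1\<^esub>\<close>; applying \<open>\<Delta>\<close> to the first
  relation and eliminating \<open>Q\<^bsub>n-1\<^esub>\<close> gives the difference equation.  The rational functions \<open>\<Lambda>\<close> and
  \<open>\<Xi>\<^sub>1\<close> have finitely many zeros because their limits at infinity are nonzero: both are controlled
  by \<open>lim x B1(x; n) = \<lambda> \<Delta>Q\<^sub>n(c) \<Delta>C\<^sub>n(c) / \<parallel>C\<^bsub>n-1\<^esub>\<parallel>\<^sup>2\<close>, which is nonnegative since \<open>\<lambda> \<ge> 0\<close>.\<close>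

section \<open>Rational functions on a set\<close>

lemma rational_on_const: "rational_on X (\<lambda>x. e)"
  unfolding rational_on_def by (intro exI[of _ "[:e:]"] exI[of _ 1]) simp

lemma rational_on_ident: "rational_on X (\<lambda>x. x)"
  unfolding rational_on_def by (intro exI[of _ "[:0, 1:]"] exI[of _ 1]) simp

lemma rational_on_add:
  assumes "rational_on X f" "rational_on X g"
  shows "rational_on X (\<lambda>x. f x + g x)"
proof -
  obtain p q r s where "\<forall>x\<in>X. poly q x \<noteq> 0 \<and> f x = poly p x / poly q x"
    "\<forall>x\<in>X. poly s x \<noteq> 0 \<and> g x = poly r x / poly s x"
    using assms unfolding rational_on_def by blast
  then show ?thesis unfolding rational_on_def
    by (intro exI[of _ "p * s + r * q"] exI[of _ "q * s"]) (simp add: add_frac_eq)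
qed

lemma rational_on_mult:
  assumes "rational_on X f" "rational_on X g"
  shows "rational_on X (\<lambda>x. f x * g x)"
proof -
  obtain p q r s where "\<forall>x\<in>X. poly q x \<noteq> 0 \<and> f x = poly p x / poly q x"
    "\<forall>x\<in>X. poly s x \<noteq> 0 \<and> g x = poly r x / poly s x"
    using assms unfolding rational_on_def by blast
  then show ?thesis unfolding rational_on_def
    by (intro exI[of _ "p * r"] exI[of _ "q * s"]) simp
qed

lemma rational_on_minus: "rational_on X f \<Longrightarrow> rational_on X (\<lambda>x. - f x)"
  using rational_on_mult[OF rational_on_const[of X "-1"]] by simp

lemma rational_on_diff:
  "rational_on X f \<Longrightarrow> rational_on X g \<Longrightarrow> rational_on X (\<lambda>x. f x - g x)"
  using rational_on_add[of X f "\<lambda>x. - g x"] rational_on_minus[of X g] by simp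

lemma rational_on_divide:
  assumes "rational_on X f" "rational_on X g" "\<And>x. x \<in> X \<Longrightarrow> g x \<noteq> 0"
  shows "rational_on X (\<lambda>x. f x / g x)"
proof -
  obtain p q r s where "\<forall>x\<in>X. poly q x \<noteq> 0 \<and> f x = poly p x / poly q x"
    "\<forall>x\<in>X. poly s x \<noteq> 0 \<and> g x = poly r x / poly s x"
    using assms(1,2) unfolding rational_on_def by blast
  then show ?thesis unfolding rational_on_def
    using assms(3) by (intro exI[of _ "p * s"] exI[of _ "q * r"]) fastforce
qed

lemma rational_on_shift:
  assumes "rational_on Y f" "\<And>x. x \<in> X \<Longrightarrow> x + e \<in> Y"
  shows "rational_on X (\<lambda>x. f (x + e))"
proof -
  obtain p q where "\<forall>x\<in>Y. poly q x \<noteq> 0 \<and> f x = poly p x / poly q x"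
    using assms(1) unfolding rational_on_def by blast
  then show ?thesis unfolding rational_on_def using assms(2)
    by (intro exI[of _ "pcompose p [:e, 1:]"] exI[of _ "pcompose q [:e, 1:]"])
      (simp add: poly_pcompose add.commute)
qed

lemma rational_on_subset: "rational_on Y f \<Longrightarrow> X \<subseteq> Y \<Longrightarrow> rational_on X f"
  unfolding rational_on_def by blast

lemma rational_on_if:
  "(P \<Longrightarrow> rational_on X f) \<Longrightarrow> (\<not> P \<Longrightarrow> rational_on X g)
    \<Longrightarrow> rational_on X (\<lambda>x. if P then f x else g x)"
  by (cases P) auto

lemmas rational_on_intros =
  rational_on_const rational_on_ident rational_on_add rational_on_diff rational_on_mult
  rational_on_minus rational_on_divide rational_on_if

text \<open>If the numerator were zero, \<open>f\<close> would vanish on \<open>X\<close>, hence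
  near infinity because \<open>X\<close> is cofinite, and its limit would be 0. A nonzero numerator
  has finitely many roots.\<close>

lemma rational_on_finite_zeros:
  assumes f: "rational_on X f" and X: "finite (- X)"
    and lim: "(f \<longlongrightarrow> l) at_top" and l: "l \<noteq> 0"
  shows "finite {x\<in>X. f x = 0}"
proof -
  obtain p q where pq: "\<forall>x\<in>X. poly q x \<noteq> 0 \<and> f x = poly p x / poly q x"
    using f unfolding rational_on_def by blast
  have "p \<noteq> 0"
  proof
    assume "p = 0"
    \<comment> \<open>The \<open>insert 0\<close> keeps \<open>Max\<close> meaningful when the
      complement of \<open>X\<close> is empty.\<close>
    have "eventually (\<lambda>x. x \<in> X) at_top"
      using eventually_gt_at_top[of "Max (insert 0 (- X))"]
      by eventually_elim (use X Max_ge[of "insert 0 (- X)"] in \<open>fastforce simp: not_less\<close>)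
    then have "eventually (\<lambda>x. f x = 0) at_top"
      by eventually_elim (use pq \<open>p = 0\<close> in simp)
    then have "(f \<longlongrightarrow> 0) at_top" by (rule tendsto_eventually)
    then show False using tendsto_unique[OF _ lim] l by simp
  qed
  then have "finite {x. poly p x = 0}" by (rule poly_roots_finite)
  then show ?thesis by (rule rev_finite_subset) (use pq in auto)
qed

section \<open>Monic families\<close>

lemma coeff_monic:
  "degree p = n \<and> lead_coeff p = 1 \<Longrightarrow> i \<ge> n \<Longrightarrow> coeff p i = (if i = n then 1 else 0)"
  using coeff_eq_0[of p i] by auto

text \<open>Subtracting \<open>coeff p n\<close> times \<open>P n\<close> removes the top
  coefficient. Vanishing coefficients are assumed instead of a degree bound so that
  \<open>n = 0\<close> forces \<open>p = 0\<close>.\<close>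

lemma monic_family_span:
  fixes P :: "nat \<Rightarrow> 'a :: comm_ring_1 poly"
  assumes P: "\<And>k. degree (P k) = k \<and> lead_coeff (P k) = 1"
    and p: "\<And>i. i \<ge> n \<Longrightarrow> coeff p i = 0"
  obtains d where "p = (\<Sum>k<n. smult (d k) (P k))"
proof -
  have "\<exists>d. p = (\<Sum>k<n. smult (d k) (P k))"
    using p
  proof (induction n arbitrary: p)
    case 0
    then show ?case by (simp add: poly_eq_iff)
  next
    case (Suc n)
    have "coeff (p - smult (coeff p n) (P n)) i = 0" if "i \<ge> n" for i
      using P[of n] Suc.prems[of i] that coeff_eq_0[of "P n" i] by (cases "i = n") auto
    then obtain d where "p - smult (coeff p n) (P n) = (\<Sum>k<n. smult (d k) (P k))"
      using Suc.IH by blast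
    then show ?case
      by (intro exI[of _ "d(n := coeff p n)"]) (simp add: algebra_simps)
  qed
  then show ?thesis using that by blast
qed

section \<open>The Poisson inner product\<close>

text \<open>An exponential bound suffices, since \<open>(a * b) ^ k / fact k\<close> is still
  summable, and it survives the Horner step because \<open>k \<le> 2 ^ k\<close>.\<close>

lemma poly_nat_bounded_by_power:
  fixes p :: "real poly"
  obtains C b where "C \<ge> 0" "b \<ge> 1" "\<And>k. \<bar>poly p (real k)\<bar> \<le> C * b ^ k"
proof -
  have "\<exists>C b. C \<ge> 0 \<and> b \<ge> 1 \<and> (\<forall>k. \<bar>poly p (real k)\<bar> \<le> C * b ^ k)"
  proof (induction p)
    case 0
    show ?case by (intro exI[of _ 0] exI[of _ 1]) simp
  next
    case (pCons e p)
    then obtain C b where Cb: "C \<ge> 0" "b \<ge> 1" "\<And>k. \<bar>poly p (real k)\<bar> \<le> C * b ^ k"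
      by blast
    have "\<bar>poly (pCons e p) (real k)\<bar> \<le> (\<bar>e\<bar> + C) * (2 * b) ^ k" for k
    proof -
      have k: "real k \<le> 2 ^ k"
        using of_nat_less_two_power[of k, where ?'a = real] by simp
      have "\<bar>poly (pCons e p) (real k)\<bar> \<le> \<bar>e\<bar> + real k * \<bar>poly p (real k)\<bar>"
        using abs_triangle_ineq[of e "real k * poly p (real k)"] by (simp add: abs_mult)
      also have "\<dots> \<le> \<bar>e\<bar> * (2 * b) ^ k + 2 ^ k * (C * b ^ k)"
        using Cb k one_le_power[of "2 * b" k]
        by (intro add_mono mult_mono) (auto simp: mult_le_cancel_left1)
      finally show ?thesis by (simp add: power_mult_distrib algebra_simps)
    qed
    then show ?case
      using Cb by (intro exI[of _ "\<bar>e\<bar> + C"] exI[of _ "2 * b"]) auto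
  qed
  then show ?thesis using that by blast
qed

lemma summable_poisson_poly:
  fixes p :: "real poly"
  assumes "a > 0"
  shows "summable (\<lambda>k. \<bar>a ^ k / fact k * exp (- a) * poly p (real k)\<bar>)"
proof -
  obtain C b where Cb: "C \<ge> 0" "b \<ge> 1" "\<And>k. \<bar>poly p (real k)\<bar> \<le> C * b ^ k"
    using poly_nat_bounded_by_power[of p] by blast
  show ?thesis
  proof (rule summable_comparison_test')
    show "summable (\<lambda>k. exp (- a) * C * (inverse (fact k) * (a * b) ^ k))"
      by (intro summable_mult summable_exp)
    fix k :: nat
    have "norm \<bar>a ^ k / fact k * exp (- a) * poly p (real k)\<bar>
        = a ^ k / fact k * exp (- a) * \<bar>poly p (real k)\<bar>"
      using assms by (simp add: abs_mult)
    also have "\<dots> \<le> a ^ k / fact k * exp (- a) * (C * b ^ k)"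
      using assms Cb by (intro mult_left_mono) auto
    finally show "norm \<bar>a ^ k / fact k * exp (- a) * poly p (real k)\<bar>
        \<le> exp (- a) * C * (inverse (fact k) * (a * b) ^ k)"
      by (simp add: power_mult_distrib field_simps)
  qed
qed

text \<open>Pointwise equality with a polynomial lets integrands such as
  \<open>poly p x * poly q x\<close> be treated without first being rewritten as one
  \<open>poly\<close>.\<close>

lemma integrable_poisson_poly:
  assumes "a > 0" and f: "\<And>x. f x = poly p x"
  shows "integrable (measure_pmf (psi a)) f"
proof -
  have "f = poly p" using f by auto
  have "integrable (measure_pmf (poisson_pmf a)) (\<lambda>k. poly p (real k))"
    using summable_poisson_poly[OF assms(1), of p] assms(1)
    unfolding measure_pmf_eq_density
    by (subst integrable_density) (auto simp: integrable_count_space_nat_iff)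
  then show ?thesis by (simp add: psi_def \<open>f = poly p\<close>)
qed

lemma integral_poisson_poly:
  assumes "a > 0"
  shows "(\<lambda>k. a ^ k / fact k * exp (- a) * poly p (real k)) sums
    (\<integral>x. poly p x \<partial>measure_pmf (psi a))"
proof -
  have "(\<integral>x. poly p x \<partial>measure_pmf (psi a))
      = (\<integral>k. a ^ k / fact k * exp (- a) * poly p (real k) \<partial>count_space UNIV)"
    unfolding psi_def integral_map_pmf unfolding measure_pmf_eq_density
    using assms by (subst integral_density) auto
  moreover have "integrable (count_space UNIV)
      (\<lambda>k::nat. a ^ k / fact k * exp (- a) * poly p (real k))"
    using summable_poisson_poly[OF assms, of p] by (simp add: integrable_count_space_nat_iff)
  ultimately show ?thesis
    using sums_integral_count_space_nat by metis
qed

text \<open>The Stein identity of the Poisson distribution: shift the summation index in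
  \<open>\<Sum> k p(k) a^k / k!\<close>.\<close>

lemma integral_poisson_shift:
  fixes p q :: "real poly"
  assumes a: "a > 0" and pq: "\<And>x. poly q x = poly p (x + 1)"
  shows "(\<integral>x. x * poly p x \<partial>measure_pmf (psi a)) = a * (\<integral>x. poly q x \<partial>measure_pmf (psi a))"
proof -
  let ?f = "\<lambda>k. a ^ k / fact k * exp (- a) * poly ([:0, 1:] * p) (real k)"
  have "(\<lambda>k. ?f (Suc k)) = (\<lambda>k. a * (a ^ k / fact k * exp (- a) * poly q (real k)))"
    by (rule ext) (simp add: pq divide_simps add.commute)
  then have "(\<lambda>k. ?f (Suc k)) sums (a * (\<integral>x. poly q x \<partial>measure_pmf (psi a)))"
    using sums_mult[OF integral_poisson_poly[OF a, of q], of a] by (simp only:)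
  \<comment> \<open>The term restored at index 0 is zero because of the factor
    \<open>[:0, 1:]\<close>.\<close>
  then have "?f sums (a * (\<integral>x. poly q x \<partial>measure_pmf (psi a)))"
    by (subst (asm) sums_Suc_iff) simp
  from sums_unique2[OF integral_poisson_poly[OF a] this] show ?thesis by simp
qed

lemma integrable_poisson_poly_mult:
  assumes "a > 0"
  shows "integrable (measure_pmf (psi a)) (\<lambda>x. poly p x * poly q x)"
  by (rule integrable_poisson_poly[OF assms, of _ "p * q"]) simp

lemma poisson_inner_add_left:
  "a > 0 \<Longrightarrow> poisson_inner a (p + q) r = poisson_inner a p r + poisson_inner a q r"
  unfolding poisson_inner_def
  by (simp add: distrib_right integrable_poisson_poly_mult)

lemma poisson_inner_smult_left: "poisson_inner a (smult e p) r = e * poisson_inner a p r"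
  unfolding poisson_inner_def by (simp add: mult.assoc)

lemma poisson_inner_commute: "poisson_inner a p q = poisson_inner a q p"
  unfolding poisson_inner_def by (simp add: mult.commute)

lemma poisson_inner_sum_left:
  assumes "a > 0"
  shows "poisson_inner a (\<Sum>k\<in>A. smult (d k) (P k)) r = (\<Sum>k\<in>A. d k * poisson_inner a (P k) r)"
proof (induction A rule: infinite_finite_induct)
  case (insert x A)
  then show ?case by (simp add: poisson_inner_add_left[OF assms] poisson_inner_smult_left)
qed (simp_all add: poisson_inner_def)

lemma Delta_poly_sum:
  "Delta (poly (\<Sum>k\<in>A. smult (d k) (P k))) x = (\<Sum>k\<in>A. d k * Delta (poly (P k)) x)"
  by (simp add: Delta_def poly_sum sum_subtractf right_diff_distrib)

lemma sobolev_inner_sum_left: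
  assumes "a > 0"
  shows "sobolev_inner a lam c (\<Sum>k\<in>A. smult (d k) (P k)) r
    = (\<Sum>k\<in>A. d k * sobolev_inner a lam c (P k) r)"
  unfolding sobolev_inner_def Delta_poly_sum poisson_inner_sum_left[OF assms]
  by (simp add: sum.distrib sum_distrib_left sum_distrib_right algebra_simps)

section \<open>Charlier polynomials\<close>

text \<open>At \<open>n = 0\<close> the truncated index \<open>n - 1\<close> is harmless: its factor
  \<open>real n\<close> is zero, in accordance with the convention that the polynomial of index -1
  vanishes.\<close>

lemma charlier_rec:
  "poly (charlier a (Suc n)) x
    = (x - real n - a) * poly (charlier a n) x - real n * a * poly (charlier a (n - 1)) x"
  by (cases n) (simp_all add: algebra_simps)

text \<open>Apply the difference to the three-term recurrence, insert the claim for the two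
  preceding indices, and use the recurrence again one index lower.\<close>

lemma Delta_charlier:
  "Delta (poly (charlier a n)) x = real n * poly (charlier a (n - 1)) x"
proof (induction n rule: less_induct)
  case (less n)
  show ?case
  proof (cases n)
    case 0
    then show ?thesis by (simp add: Delta_def)
  next
    case (Suc m)
    show ?thesis
    proof (cases m)
      case 0
      then show ?thesis using Suc by (simp add: Delta_def)
    next
      case (Suc l)
      have IH1: "poly (charlier a (Suc l)) (x + 1)
          = poly (charlier a (Suc l)) x + real (Suc l) * poly (charlier a l) x"
        using less[of "Suc l"] \<open>n = Suc m\<close> Suc by (simp add: Delta_def)
      have IH2: "poly (charlier a l) (x + 1)
          = poly (charlier a l) x + real l * poly (charlier a (l - 1)) x"
        using less[of l] \<open>n = Suc m\<close> Suc by (simp add: Delta_def)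
      show ?thesis
        unfolding \<open>n = Suc m\<close> Suc Delta_def diff_Suc_1 charlier_rec[of a "Suc l"] IH1 IH2
        by (simp add: charlier_rec[of a l] algebra_simps)
    qed
  qed
qed

lemma poly_charlier_Suc_arg:
  "poly (charlier a n) (x + 1) = poly (charlier a n) x + real n * poly (charlier a (n - 1)) x"
  using Delta_charlier[of a n x] by (simp add: Delta_def)

text \<open>The raising operator, obtained from the lowering relation at \<open>x - 1\<close> and
  the recurrence. Its factor \<open>x\<close> is what the Stein identity acts on.\<close>

lemma charlier_raising:
  "poly (charlier a (Suc n)) x = x * poly (charlier a n) (x - 1) - a * poly (charlier a n) x"
proof (induction n)
  case 0
  show ?case by simp
next
  case (Suc n)
  have "poly (charlier a (Suc n)) (x - 1)
      = poly (charlier a (Suc n)) x - real (Suc n) * poly (charlier a n) (x - 1)"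
    using poly_charlier_Suc_arg[of a "Suc n" "x - 1"] by simp
  then have "x * poly (charlier a (Suc n)) (x - 1) = x * poly (charlier a (Suc n)) x
      - real (Suc n) * (x * poly (charlier a n) (x - 1))"
    by (simp only: right_diff_distrib mult.left_commute)
  also have "x * poly (charlier a n) (x - 1) = poly (charlier a (Suc n)) x + a * poly (charlier a n) x"
    using Suc.IH by simp
  finally have "x * poly (charlier a (Suc n)) (x - 1) = x * poly (charlier a (Suc n)) x
      - real (Suc n) * (poly (charlier a (Suc n)) x + a * poly (charlier a n) x)" .
  then show ?case unfolding charlier_rec[of a "Suc n"] by (simp add: algebra_simps)
qed

text \<open>Raising is adjoint to the difference up to the factor \<open>a\<close>: the Stein
  identity turns the integral of \<open>x C_n(x - 1) q(x)\<close> into \<open>a\<close> times that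
  of \<open>C_n(x) q(x + 1)\<close>. Here \<open>q'\<close> represents the difference of
  \<open>q\<close> as a polynomial, because \<open>Delta\<close> acts on functions.\<close>

lemma poisson_inner_charlier_Suc:
  assumes a: "a > 0" and q': "\<And>x. poly q' x = Delta (poly q) x"
  shows "poisson_inner a (charlier a (Suc n)) q = a * poisson_inner a (charlier a n) q'"
proof -
  define r where "r = pcompose (charlier a n) [:-1, 1:] * q"
  define s where "s = charlier a n * q + charlier a n * q'"
  have "poly s x = poly r (x + 1)" for x
    by (simp add: r_def s_def poly_pcompose q' Delta_def algebra_simps)
  then have shift: "(\<integral>x. x * poly r x \<partial>measure_pmf (psi a))
      = a * (\<integral>x. poly s x \<partial>measure_pmf (psi a))"
    by (rule integral_poisson_shift[OF a])
  have "poisson_inner a (charlier a (Suc n)) q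
      = (\<integral>x. x * poly r x - a * (poly (charlier a n) x * poly q x) \<partial>measure_pmf (psi a))"
    unfolding poisson_inner_def
    by (rule Bochner_Integration.integral_cong)
      (simp_all add: charlier_raising r_def poly_pcompose algebra_simps)
  also have "\<dots> = (\<integral>x. x * poly r x \<partial>measure_pmf (psi a)) - a * poisson_inner a (charlier a n) q"
    using integrable_poisson_poly[OF a, of "\<lambda>x. x * poly r x" "[:0, 1:] * r"] integrable_poisson_poly_mult[OF a]
    unfolding poisson_inner_def by simp
  also have "(\<integral>x. x * poly r x \<partial>measure_pmf (psi a))
      = a * (poisson_inner a (charlier a n) q + poisson_inner a (charlier a n) q')"
    unfolding shift poisson_inner_def s_def poly_add poly_mult
    by (simp add: integrable_poisson_poly_mult[OF a])
  finally show ?thesis by (simp add: algebra_simps)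
qed

text \<open>Each use of the adjoint relation lowers both indices and produces a factor
  \<open>a * n\<close>, until one index reaches 0.\<close>

lemma poisson_inner_charlier:
  assumes a: "a > 0"
  shows "poisson_inner a (charlier a m) (charlier a n) = (if m = n then fact n * a ^ n else 0)"
proof (induction m arbitrary: n)
  case (Suc m)
  have "poisson_inner a (charlier a (Suc m)) (charlier a n)
      = a * poisson_inner a (charlier a m) (smult (real n) (charlier a (n - 1)))"
    by (rule poisson_inner_charlier_Suc[OF a]) (simp add: Delta_charlier)
  also have "\<dots> = a * real n * poisson_inner a (charlier a m) (charlier a (n - 1))"
    by (simp add: poisson_inner_def mult_ac flip: integral_mult_right_zero)
  finally show ?case
    by (cases n) (simp_all add: Suc.IH)
next
  case 0
  show ?case
  proof (cases n)
    case 0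
    then show ?thesis by (simp add: poisson_inner_def)
  next
    case (Suc l)
    \<comment> \<open>With the two arguments exchanged by symmetry, the difference falls on the
      constant 1 and gives 0.\<close>
    have "poisson_inner a (charlier a n) (charlier a 0) = a * poisson_inner a (charlier a l) 0"
      unfolding Suc by (rule poisson_inner_charlier_Suc[OF a]) (simp add: Delta_def)
    then show ?thesis using Suc by (simp add: poisson_inner_commute) (simp add: poisson_inner_def)
  qed
qed

lemma charlier_norm_sq_eq: "a > 0 \<Longrightarrow> charlier_norm_sq a n = fact n * a ^ n"
  by (simp add: charlier_norm_sq_def poisson_inner_charlier)

lemma charlier_norm_sq_pos: "a > 0 \<Longrightarrow> charlier_norm_sq a n > 0"
  by (simp add: charlier_norm_sq_eq)

lemma charlier_norm_sq_Suc:
  "a > 0 \<Longrightarrow> charlier_norm_sq a (Suc n) = real (Suc n) * a * charlier_norm_sq a n"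
  by (simp add: charlier_norm_sq_eq)

lemma charlier_monic: "degree (charlier a n) = n \<and> lead_coeff (charlier a n) = 1"
proof (induction n rule: less_induct)
  case (less n)
  consider "n = 0" | "n = 1" | m where "n = Suc (Suc m)"
    by (metis One_nat_def not0_implies_Suc)
  then show ?case
  proof cases
    case 3
    define l :: "real poly" where "l = [:- real (Suc m) - a, 1:]"
    define p where "p = charlier a (Suc m)"
    define q where "q = - smult (real (Suc m) * a) (charlier a m)"
    have l: "l \<noteq> 0" "degree l = 1" "lead_coeff l = 1" by (simp_all add: l_def)
    have p: "degree p = Suc m" "lead_coeff p = 1"
      using less.IH[of "Suc m"] 3 unfolding p_def by blast+
    then have "p \<noteq> 0" by force
    then have lp: "degree (l * p) = n" "lead_coeff (l * p) = 1"
      using degree_mult_eq[of l p] lead_coeff_mult[of l p] l p 3 by simp_all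
    have "degree (charlier a m) = m" using less.IH[of m] 3 by simp
    then have q: "degree q < degree (l * p)"
      unfolding lp using 3 by (simp add: q_def le_less_trans[OF degree_smult_le])
    have eq: "charlier a n = q + l * p" unfolding 3 by (simp add: l_def p_def q_def)
    show ?thesis
      unfolding eq using degree_add_eq_right[OF q] lead_coeff_add_le[OF q] lp by metis
  qed simp_all
qed

text \<open>Expanding the top polynomials by the recurrence in both variables leaves the new summand
  times \<open>x - y\<close> and \<open>(n + 1) * a\<close> times the old numerator; that factor is
  the ratio of consecutive squared norms.\<close>

lemma charlier_christoffel_darboux:
  assumes a: "a > 0"
  shows "(x - y) * (\<Sum>k\<le>n. poly (charlier a k) x * poly (charlier a k) y / charlier_norm_sq a k)
    = (poly (charlier a (Suc n)) x * poly (charlier a n) y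
       - poly (charlier a n) x * poly (charlier a (Suc n)) y) / charlier_norm_sq a n"
proof (induction n)
  case 0
  show ?case by simp
next
  case (Suc n)
  have h: "charlier_norm_sq a n \<noteq> 0" using charlier_norm_sq_pos[OF a, of n] by simp
  show ?case
    unfolding sum.atMost_Suc distrib_left Suc.IH charlier_norm_sq_Suc[OF a]
      charlier_rec[of a "Suc n"]
    using h a by (simp add: divide_simps del: of_nat_Suc) (simp add: algebra_simps)
qed

section \<open>Sobolev-type Charlier polynomials\<close>

locale charlier_sobolev =
  fixes a lam c :: real and Q :: "nat \<Rightarrow> real poly"
  assumes a_pos: "a > 0" and lam_nonneg: "lam \<ge> 0" and Q: "sobolev_charlier a lam c Q"
begin

abbreviation "C \<equiv> charlier a"
abbreviation "h \<equiv> charlier_norm_sq a"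

section \<open>Expansion in Charlier polynomials\<close>

lemma Q_monic: "degree (Q k) = k \<and> lead_coeff (Q k) = 1"
  using Q unfolding sobolev_charlier_def by blast

lemma Q_orthogonal: "j \<noteq> k \<Longrightarrow> sobolev_inner a lam c (Q j) (Q k) = 0"
  using Q unfolding sobolev_charlier_def by blast

text \<open>\<open>C k\<close> lies in the span of \<open>Q 0\<close>, ..., \<open>Q k\<close>, all
  Sobolev-orthogonal to \<open>Q n\<close>, so the integral part is minus the difference term at
  \<open>c\<close>.\<close>

lemma poisson_inner_Q_charlier:
  assumes "k < n"
  shows "poisson_inner a (Q n) (C k) = - lam * Delta (poly (Q n)) c * Delta (poly (C k)) c"
proof -
  have "coeff (C k) i = 0" if "i \<ge> Suc k" for i
    using coeff_monic[OF charlier_monic[of a k], of i] that by simp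
  with monic_family_span[where p = "C k" and n = "Suc k", OF Q_monic]
  obtain d where d: "C k = (\<Sum>j<Suc k. smult (d j) (Q j))" .
  have "sobolev_inner a lam c (C k) (Q n) = (\<Sum>j<Suc k. d j * sobolev_inner a lam c (Q j) (Q n))"
    by (subst d, rule sobolev_inner_sum_left[OF a_pos])
  also have "\<dots> = 0"
    using Q_orthogonal assms by (intro sum.neutral) auto
  finally show ?thesis
    by (simp add: sobolev_inner_def poisson_inner_commute[of a "Q n"] algebra_simps)
qed

text \<open>Both \<open>Q n\<close> and \<open>C n\<close> are monic, so they differ by a
  combination of lower Charlier polynomials, whose coefficients come from pairing with
  \<open>C k\<close>.\<close>

lemma Q_expansion:
  "Q n = C n + (\<Sum>k<n. smult (- lam * Delta (poly (Q n)) c * Delta (poly (C k)) c / h k) (C k))"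
proof -
  have "coeff (Q n - C n) i = 0" if "i \<ge> n" for i
    using coeff_monic[OF Q_monic[of n] that] coeff_monic[OF charlier_monic[of a n] that] by simp
  with monic_family_span[where p = "Q n - C n" and n = n, OF charlier_monic]
  obtain d where d: "Q n - C n = (\<Sum>k<n. smult (d k) (C k))" .
  have "d k = - lam * Delta (poly (Q n)) c * Delta (poly (C k)) c / h k" if "k < n" for k
  proof -
    have "poisson_inner a (Q n) (C k)
        = poisson_inner a (C n) (C k) + poisson_inner a (Q n - C n) (C k)"
      using poisson_inner_add_left[OF a_pos, of "C n" "Q n - C n" "C k"] by simp
    also have "\<dots> = (\<Sum>j<n. d j * poisson_inner a (C j) (C k))"
      unfolding d poisson_inner_sum_left[OF a_pos] using that
      by (simp add: poisson_inner_charlier[OF a_pos])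
    also have "\<dots> = (\<Sum>j<n. if j = k then d k * h k else 0)"
      by (rule sum.cong) (auto simp: charlier_norm_sq_def poisson_inner_charlier[OF a_pos])
    also have "\<dots> = d k * h k" using that by simp
    finally have "d k * h k = - lam * Delta (poly (Q n)) c * Delta (poly (C k)) c"
      using poisson_inner_Q_charlier[OF that] by simp
    then show ?thesis
      using charlier_norm_sq_pos[OF a_pos, of k] by (simp only: eq_divide_eq) simp
  qed
  then have "(\<Sum>k<n. smult (d k) (C k))
      = (\<Sum>k<n. smult (- lam * Delta (poly (Q n)) c * Delta (poly (C k)) c / h k) (C k))"
    by (intro sum.cong) auto
  then show ?thesis using d by (simp add: algebra_simps)
qed

lemma poly_Q_expansion:
  "poly (Q n) x = poly (C n) x
    - lam * Delta (poly (Q n)) c * (\<Sum>k<n. poly (C k) x * Delta (poly (C k)) c / h k)"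
  by (subst Q_expansion) (simp add: poly_sum sum_distrib_left sum_negf mult_ac)

text \<open>Apply \<open>\<Delta>\<close> at \<open>c\<close> to the expansion: \<open>\<Delta>Q\<^sub>n(c) (1 + \<lambda> K) = \<Delta>C\<^sub>n(c)\<close> with \<open>K \<ge> 0\<close>.\<close>

lemma Delta_Q_charlier_nonneg: "Delta (poly (Q n)) c * Delta (poly (C n)) c \<ge> 0"
proof -
  define K where "K = (\<Sum>k<n. (Delta (poly (C k)) c)\<^sup>2 / h k)"
  have "K \<ge> 0"
    unfolding K_def using charlier_norm_sq_pos[OF a_pos]
    by (intro sum_nonneg divide_nonneg_pos) auto
  \<comment> \<open>A separate name for the difference at \<open>c\<close> keeps the rewriting by
    the expansion below from unfolding it again and again.\<close>
  define D where "D = Delta (poly (Q n)) c"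
  have K: "K = (\<Sum>k<n. poly (C k) (c + 1) * Delta (poly (C k)) c / h k)
      - (\<Sum>k<n. poly (C k) c * Delta (poly (C k)) c / h k)"
    unfolding K_def sum_subtractf[symmetric]
    by (intro sum.cong)
      (simp_all add: Delta_def power2_eq_square left_diff_distrib diff_divide_distrib)
  have "Delta (poly (Q n)) c = Delta (poly (C n)) c - lam * D * K"
    unfolding K Delta_def[of "poly (Q n)"] Delta_def[of "poly (C n)"]
      poly_Q_expansion[of n, folded D_def]
    by (simp add: right_diff_distrib)
  then have "Delta (poly (C n)) c = Delta (poly (Q n)) c * (1 + lam * K)"
    by (simp add: D_def algebra_simps)
  then have "Delta (poly (Q n)) c * Delta (poly (C n)) c
      = (Delta (poly (Q n)) c)\<^sup>2 * (1 + lam * K)"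
    by (simp add: power2_eq_square)
  then show ?thesis using \<open>K \<ge> 0\<close> lam_nonneg by simp
qed

section \<open>Connection formulas, structure relations and the difference equation\<close>

abbreviation "A1 \<equiv> coefA1 a lam c Q"
abbreviation "B1 \<equiv> coefB1 a lam c Q"
abbreviation "C1 \<equiv> coefC1 a lam c Q"
abbreviation "D1 \<equiv> coefD1 a lam c Q"
abbreviation "A2 \<equiv> coefA2 a lam c Q"
abbreviation "B2 \<equiv> coefB2 a lam c Q"
abbreviation "C2 \<equiv> coefC2 a lam c Q"
abbreviation "D2 \<equiv> coefD2 a lam c Q"
abbreviation "L \<equiv> Lam a lam c Q"
abbreviation "X1 \<equiv> Xi1 a lam c Q"
abbreviation "X2 \<equiv> Xi2 a lam c Q"
abbreviation "T1 \<equiv> Theta1 a lam c Q"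
abbreviation "T2 \<equiv> Theta2 a lam c Q"

text \<open>The sum in the expansion is the Christoffel--Darboux kernel differenced in its second
  variable between \<open>c\<close> and \<open>c + 1\<close>; the closed form at these two points
  produces the poles there.\<close>

lemma Q_connection:
  assumes n: "n \<ge> 1" and x: "(x - c) * (x - c - 1) \<noteq> 0"
  shows "poly (Q n) x = A1 n x * poly (C n) x + B1 n x * poly (C (n - 1)) x"
proof -
  obtain m where m: "n = Suc m" using n by (cases n) auto
  define S where "S y = (\<Sum>k\<le>m. poly (C k) x * poly (C k) y / h k)" for y
  define u where "u = poly (C m) c"
  define u' where "u' = poly (C m) (c + 1)"
  define v where "v = poly (C n) c"
  define v' where "v' = poly (C n) (c + 1)"
  define F where "F w w' = (w + (x - c) * (w' - w)) / ((x - c) * (x - c - 1))" for w w'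
  have x': "x - c \<noteq> 0" "x - c - 1 \<noteq> 0" using x by auto
  \<comment> \<open>Merging the two fractions yields the numerators of \<open>coefA1\<close> and
    \<open>coefB1\<close>, with \<open>w' - w\<close> as the difference at \<open>c\<close>.\<close>
  have frac: "w' / (x - c - 1) - w / (x - c)
      = F w w'" for w w'
    unfolding F_def by (subst diff_frac_eq[OF x'(2,1)]) (simp add: algebra_simps)
  have regroup: "(p * u' - r * v') / (k * s) - (p * u - r * v) / (k * t)
      = ((u' / s - u / t) * p - (v' / s - v / t) * r) / k" for p r k s t :: real
    by (simp add: diff_divide_distrib add_divide_distrib algebra_simps)
  have S: "S y = (poly (C n) x * poly (C m) y - poly (C m) x * poly (C n) y) / (h m * (x - y))"
    if "x - y \<noteq> 0" for y
    using charlier_christoffel_darboux[OF a_pos, of x y m] that charlier_norm_sq_pos[OF a_pos, of m]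
    unfolding S_def m by (simp add: divide_simps) (simp add: algebra_simps)
  have "(\<Sum>k<n. poly (C k) x * Delta (poly (C k)) c / h k) = S (c + 1) - S c"
    unfolding S_def m lessThan_Suc_atMost sum_subtractf[symmetric]
    by (intro sum.cong) (simp_all add: Delta_def algebra_simps diff_divide_distrib)
  also have "\<dots> = (poly (C n) x * u' - poly (C m) x * v') / (h m * (x - c - 1))
      - (poly (C n) x * u - poly (C m) x * v) / (h m * (x - c))"
    using S[of "c + 1"] S[of c] x' by (simp add: u_def u'_def v_def v'_def algebra_simps)
  also have "\<dots> = ((u' / (x - c - 1) - u / (x - c)) * poly (C n) x
      - (v' / (x - c - 1) - v / (x - c)) * poly (C m) x) / h m"
    by (rule regroup)
  also have "\<dots> = (F u u' * poly (C n) x - F v v' * poly (C m) x) / h m"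
    unfolding frac ..
  finally have kernel: "(\<Sum>k<n. poly (C k) x * Delta (poly (C k)) c / h k)
      = (F u u' * poly (C n) x - F v v' * poly (C m) x) / h m" .
  have AB: "A1 n x = 1 - lam * (Delta (poly (Q n)) c / h m) * F u u'"
    "B1 n x = lam * (Delta (poly (Q n)) c / h m) * F v v'"
    by (simp_all only: coefA1_def coefB1_def m u_def u'_def v_def v'_def F_def Delta_def diff_Suc_1)
  show ?thesis
    unfolding poly_Q_expansion[of n x] kernel AB
    by (simp add: m diff_divide_distrib algebra_simps)
qed

text \<open>The lowering relation brings in \<open>C (n - 2)\<close>, which the recurrence trades
  for \<open>C n\<close> and \<open>C (n - 1)\<close>; differences thus stay in terms of these
  two.\<close>

lemma charlier_pred_shift:
  assumes "n \<ge> 1"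
  shows "poly (C (n - 1)) (x + 1)
    = (x - real n + 1) / a * poly (C (n - 1)) x - 1 / a * poly (C n) x"
proof -
  obtain m where m: "n = Suc m" using assms by (cases n) auto
  show ?thesis
    using a_pos unfolding m diff_Suc_1 poly_charlier_Suc_arg[of a m x] charlier_rec[of a m x]
    by (simp add: field_simps)
qed

text \<open>The connection formula at index \<open>n - 1\<close>, with \<open>C (n - 2)\<close>
  eliminated by the recurrence. For \<open>n = 1\<close> it reads \<open>Q 0 = C 0\<close>.\<close>

lemma Q_pred_connection:
  assumes n: "n \<ge> 1" and x: "(x - c) * (x - c - 1) \<noteq> 0"
  shows "poly (Q (n - 1)) x = A2 n x * poly (C n) x + B2 n x * poly (C (n - 1)) x"
proof (cases "n = 1")
  case True
  have "Q 0 = 1" using Q_expansion[of 0] by simp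
  then show ?thesis using True by (simp add: coefA2_def coefB2_def)
next
  case False
  define m where "m = n - 2"
  have m: "n = Suc (Suc m)" using False n by (simp add: m_def)
  have "poly (Q (Suc m)) x = A1 (Suc m) x * poly (C (Suc m)) x + B1 (Suc m) x * poly (C m) x"
    using Q_connection[of "Suc m" x] x by simp
  then show ?thesis
    using a_pos unfolding m charlier_rec[of a "Suc m"] coefA2_def coefB2_def
    by (simp add: divide_simps) (simp add: algebra_simps)
qed

text \<open>\<open>C2\<close> and \<open>D2\<close> arise from \<open>A2\<close> and
  \<open>B2\<close> exactly as \<open>C1\<close> and \<open>D1\<close> do from \<open>A1\<close> and
  \<open>B1\<close>, so \<open>Delta_Q_pred\<close> can follow the computation of
  \<open>Delta_Q\<close>.\<close>

lemma coefC2_eq: "n \<ge> 1 \<Longrightarrow> C2 n x = A2 n (x + 1) - A2 n x - 1 / a * B2 n (x + 1)"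
  using a_pos by (simp add: coefA2_def coefB2_def coefC2_def divide_simps)
    (simp add: algebra_simps power2_eq_square)

lemma coefD2_eq:
  "n \<ge> 1 \<Longrightarrow> D2 n x = real n * A2 n (x + 1) - B2 n x + (x - real n + 1) / a * B2 n (x + 1)"
  using a_pos by (simp add: coefA2_def coefB2_def coefD2_def divide_simps)
    (simp add: algebra_simps power2_eq_square)

lemma Delta_Q:
  assumes n: "n \<ge> 1" and x: "(x - c) * (x - c - 1) \<noteq> 0" "(x + 1 - c) * (x + 1 - c - 1) \<noteq> 0"
  shows "Delta (poly (Q n)) x = C1 n x * poly (C n) x + D1 n x * poly (C (n - 1)) x"
  unfolding Delta_def Q_connection[OF n x(1)] Q_connection[OF n x(2)]
    charlier_pred_shift[OF n] poly_charlier_Suc_arg[of a n] coefC1_def coefD1_def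
  by (simp add: algebra_simps)

lemma Delta_Q_pred:
  assumes n: "n \<ge> 1" and x: "(x - c) * (x - c - 1) \<noteq> 0" "(x + 1 - c) * (x + 1 - c - 1) \<noteq> 0"
  shows "Delta (poly (Q (n - 1))) x = C2 n x * poly (C n) x + D2 n x * poly (C (n - 1)) x"
  unfolding Delta_def Q_pred_connection[OF n x(1)] Q_pred_connection[OF n x(2)]
    charlier_pred_shift[OF n] poly_charlier_Suc_arg[of a n] coefC2_eq[OF n] coefD2_eq[OF n]
  by (simp add: algebra_simps)

text \<open>The structure relations: solve the two connection formulas for \<open>C\<^sub>n\<close> and \<open>C\<^bsub>n-1\<^esub>\<close> by
  Cramer's rule.\<close>

lemma structure_relation:
  assumes n: "n \<ge> 1" and x: "(x - c) * (x - c - 1) \<noteq> 0" "(x + 1 - c) * (x + 1 - c - 1) \<noteq> 0"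
    and L: "L n x \<noteq> 0"
  shows "Delta (poly (Q n)) x = X2 n x * poly (Q n) x - X1 n x * poly (Q (n - 1)) x"
    and "Delta (poly (Q (n - 1))) x = T2 n x * poly (Q n) x - T1 n x * poly (Q (n - 1)) x"
proof -
  note conn = Q_connection[OF n x(1)] Q_pred_connection[OF n x(1)]
  have u: "poly (C n) x * L n x = B2 n x * poly (Q n) x - B1 n x * poly (Q (n - 1)) x"
    and v: "poly (C (n - 1)) x * L n x = A1 n x * poly (Q (n - 1)) x - A2 n x * poly (Q n) x"
    unfolding conn Lam_def by algebra+
  have "Delta (poly (Q n)) x * L n x = C1 n x * (poly (C n) x * L n x)
      + D1 n x * (poly (C (n - 1)) x * L n x)"
    unfolding Delta_Q[OF n x] by (simp add: algebra_simps)
  then have "Delta (poly (Q n)) x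
      = (C1 n x * (poly (C n) x * L n x) + D1 n x * (poly (C (n - 1)) x * L n x)) / L n x"
    using L by (simp add: eq_divide_eq)
  then show "Delta (poly (Q n)) x = X2 n x * poly (Q n) x - X1 n x * poly (Q (n - 1)) x"
    unfolding u v Xi1_def Xi2_def
    by (simp add: diff_divide_distrib add_divide_distrib algebra_simps)
  have "Delta (poly (Q (n - 1))) x * L n x = C2 n x * (poly (C n) x * L n x)
      + D2 n x * (poly (C (n - 1)) x * L n x)"
    unfolding Delta_Q_pred[OF n x] by (simp add: algebra_simps)
  then have "Delta (poly (Q (n - 1))) x
      = (C2 n x * (poly (C n) x * L n x) + D2 n x * (poly (C (n - 1)) x * L n x)) / L n x"
    using L by (simp add: eq_divide_eq)
  then show "Delta (poly (Q (n - 1))) x = T2 n x * poly (Q n) x - T1 n x * poly (Q (n - 1)) x"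
    unfolding u v Theta1_def Theta2_def
    by (simp add: diff_divide_distrib add_divide_distrib algebra_simps)
qed

text \<open>The second difference needs the first structure relation at both \<open>x\<close> and
  \<open>x + 1\<close>, hence the conditions on \<open>Lam\<close> at both points and on poles up to
  \<open>x + 2\<close>.\<close>

lemma difference_equation:
  assumes n: "n \<ge> 1" and x: "x \<in> regular_points a lam c Q n"
  shows "Delta (Delta (poly (Q n))) x + coefR a lam c Q n x * Delta (poly (Q n)) x
    + coefS a lam c Q n x * poly (Q n) x = 0"
proof -
  have nz: "(x - c) * (x - c - 1) \<noteq> 0" "(x + 1 - c) * (x + 1 - c - 1) \<noteq> 0"
      "(x + 1 + 1 - c) * (x + 1 + 1 - c - 1) \<noteq> 0"
    and L: "L n x \<noteq> 0" "L n (x + 1) \<noteq> 0" and X1: "X1 n x \<noteq> 0"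
    using x by (auto simp: regular_points_def add.assoc)
  define q where "q = poly (Q n) x"
  define r where "r = poly (Q (n - 1)) x"
  define dq where "dq = Delta (poly (Q n)) x"
  define dr where "dr = Delta (poly (Q (n - 1))) x"
  have dq: "dq = X2 n x * q - X1 n x * r" and dr: "dr = T2 n x * q - T1 n x * r"
    using structure_relation[OF n nz(1,2) L(1)] by (simp_all add: q_def r_def dq_def dr_def)
  \<comment> \<open>All division by \<open>X1\<close> is confined to \<open>w\<close>. Its product
    with \<open>X1 n x\<close> is exactly what cancels the coefficient of \<open>Q (n - 1)\<close>,
    so a polynomial identity remains.\<close>
  define w where "w = (T1 n x - 1) * Delta (X1 n) x / X1 n x"
  have w: "w * X1 n x = (T1 n x - 1) * (X1 n (x + 1) - X1 n x)"
    using X1 by (simp add: w_def Delta_def)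
  have R: "coefR a lam c Q n x = w - (X2 n (x + 1) - X2 n x) + T1 n x - X2 n x"
    by (simp add: coefR_def w_def Delta_def)
  have S: "coefS a lam c Q n x = T2 n x * X1 n (x + 1) - (X2 n (x + 1) - X2 n x)
      - T1 n x * X2 n x - X2 n x * w"
    by (simp add: coefS_def w_def Delta_def)
  have shift: "poly (Q n) (x + 1) = q + dq" "poly (Q (n - 1)) (x + 1) = r + dr"
    by (simp_all add: q_def r_def dq_def dr_def Delta_def)
  have "Delta (Delta (poly (Q n))) x = Delta (poly (Q n)) (x + 1) - dq"
    by (simp add: Delta_def[of "Delta (poly (Q n))"] dq_def)
  also have "\<dots> = X2 n (x + 1) * (q + dq) - X1 n (x + 1) * (r + dr) - dq"
    using structure_relation(1)[OF n nz(2,3) L(2)] unfolding shift by simp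
  finally have second: "Delta (Delta (poly (Q n))) x
      = X2 n (x + 1) * (q + dq) - X1 n (x + 1) * (r + dr) - dq" .
  show ?thesis
    unfolding second dq_def[symmetric] q_def[symmetric] R S unfolding dr dq
    using w by algebra
qed

end

section \<open>Limits at infinity and exceptional points\<close>

text \<open>Used with \<open>u\<close> and \<open>v\<close> the value and the difference at
  \<open>c\<close> of a Charlier polynomial.\<close>

lemma kernel_quotient_limits:
  fixes u v c :: real
  shows "((\<lambda>x. (u + (x - c) * v) / ((x - c) * (x - c - 1))) \<longlongrightarrow> 0) at_top"
    and "((\<lambda>x. x * ((u + (x - c) * v) / ((x - c) * (x - c - 1)))) \<longlongrightarrow> v) at_top"
  by real_asymp+

lemma tendsto_shift_at_top:
  fixes f :: "real \<Rightarrow> real"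
  assumes "(f \<longlongrightarrow> l) at_top"
  shows "((\<lambda>x. f (x + 1)) \<longlongrightarrow> l) at_top"
  by (rule filterlim_compose[OF assms]) real_asymp

context charlier_sobolev
begin

definition coef_domain where "coef_domain = {x. (x - c) * (x - c - 1) \<noteq> 0 \<and> (x + 1 - c) * (x + 1 - c - 1) \<noteq> 0}"

text \<open>The limit of \<open>x * B1 n x\<close>. It enters wherever \<open>B1\<close> is
  multiplied by a factor linear in \<open>x\<close>, as in \<open>D1\<close> and
  \<open>B2\<close>.\<close>

definition \<beta> where
  "\<beta> n = lam * (Delta (poly (Q n)) c / h (n - 1)) * Delta (poly (C n)) c"

lemma \<beta>_nonneg: "\<beta> n \<ge> 0"
proof -
  have "\<beta> n = lam * (Delta (poly (Q n)) c * Delta (poly (C n)) c) / h (n - 1)"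
    by (simp add: \<beta>_def)
  also have "\<dots> \<ge> 0"
    by (rule divide_nonneg_pos[OF mult_nonneg_nonneg[OF lam_nonneg Delta_Q_charlier_nonneg]
          charlier_norm_sq_pos[OF a_pos]])
  finally show ?thesis .
qed

lemma finite_compl_coef_domain: "finite (- coef_domain)"
  by (rule finite_subset[of _ "{c, c + 1, c - 1}"]) (auto simp: coef_domain_def)

lemma A1_lim: "(A1 n \<longlongrightarrow> 1) at_top"
  unfolding coefA1_def
  by (rule tendsto_eq_intros tendsto_mult_right_zero kernel_quotient_limits(1) | simp)+

lemma B1_lim: "(B1 n \<longlongrightarrow> 0) at_top"
  unfolding coefB1_def by (intro tendsto_mult_right_zero kernel_quotient_limits(1))

lemma xB1_lim: "((\<lambda>x. x * B1 n x) \<longlongrightarrow> \<beta> n) at_top"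
  unfolding coefB1_def \<beta>_def mult.left_commute[of _ "lam * _"]
  by (intro tendsto_mult_left kernel_quotient_limits(2))

lemma xB1_shift_lim: "((\<lambda>x. x * B1 n (x + 1)) \<longlongrightarrow> \<beta> n) at_top"
  \<comment> \<open>Write \<open>x\<close> as \<open>(x + 1) - 1\<close>.\<close>
  using tendsto_diff[OF tendsto_shift_at_top[OF xB1_lim] tendsto_shift_at_top[OF B1_lim], of n n]
  by (simp add: algebra_simps)

lemma C1_lim: "(C1 n \<longlongrightarrow> 0) at_top"
  unfolding coefC1_def
  by (rule tendsto_eq_intros A1_lim tendsto_shift_at_top B1_lim refl | simp)+

lemma D1_lim: "(D1 n \<longlongrightarrow> real n + \<beta> n / a) at_top"
proof -
  have eq: "D1 n = (\<lambda>x. real n * A1 n (x + 1) - B1 n x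
      + (x * B1 n (x + 1) / a + (1 - real n) / a * B1 n (x + 1)))"
    by (rule ext) (simp add: coefD1_def diff_divide_distrib add_divide_distrib algebra_simps)
  have "(D1 n \<longlongrightarrow> real n * 1 - 0 + (\<beta> n / a + (1 - real n) / a * 0)) at_top"
    unfolding eq using a_pos
    by (intro tendsto_add tendsto_diff tendsto_mult_left tendsto_divide tendsto_const B1_lim
        xB1_shift_lim tendsto_shift_at_top[OF A1_lim] tendsto_shift_at_top[OF B1_lim]) simp
  then show ?thesis by simp
qed

lemma A2_lim: "(A2 n \<longlongrightarrow> 0) at_top"
proof (cases "n = 1")
  case False
  then have "A2 n = (\<lambda>x. - B1 (n - 1) x / (a * (real n - 1)))" by (simp add: coefA2_def fun_eq_iff)
  then show ?thesis
    using tendsto_minus[OF tendsto_divide_zero[OF B1_lim]] by simp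
qed (simp add: coefA2_def[abs_def])

text \<open>The limit is 1 for \<open>n = 1\<close> and
  \<open>1 + \<beta> (n - 1) / (a * (n - 1))\<close> otherwise; nonnegativity of
  \<open>\<beta>\<close> makes it positive.\<close>

lemma B2_lim:
  assumes n: "n \<ge> 1"
  obtains l where "l > 0" "(B2 n \<longlongrightarrow> l) at_top"
proof (cases "n = 1")
  case True
  then have "B2 n = (\<lambda>x. 1)" by (simp add: coefB2_def fun_eq_iff)
  then show ?thesis using that[of 1] by simp
next
  case False
  define e where "e = a * (real n - 1)"
  have e: "e > 0" using False n a_pos by (simp add: e_def)
  have "B2 n = (\<lambda>x. A1 (n - 1) x + (x * B1 (n - 1) x / e + (1 - real n - a) / e * B1 (n - 1) x))"
    using False unfolding coefB2_def e_def[symmetric]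
    by (simp add: fun_eq_iff diff_divide_distrib add_divide_distrib algebra_simps)
  moreover have "((\<lambda>x. A1 (n - 1) x + (x * B1 (n - 1) x / e + (1 - real n - a) / e * B1 (n - 1) x))
      \<longlongrightarrow> 1 + (\<beta> (n - 1) / e + (1 - real n - a) / e * 0)) at_top"
    using e by (intro tendsto_add tendsto_mult_left tendsto_divide tendsto_const A1_lim B1_lim
        xB1_lim) simp
  ultimately have "(B2 n \<longlongrightarrow> 1 + \<beta> (n - 1) / e) at_top" by simp
  moreover have "1 + \<beta> (n - 1) / e > 0"
    using \<beta>_nonneg[of "n - 1"] e by (simp add: add_pos_nonneg)
  ultimately show ?thesis using that by blast
qed

text \<open>\<open>A1\<close> tends to 1 while \<open>B1\<close> and \<open>A2\<close> tend to 0, so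
  only the limit of \<open>B2\<close> survives.\<close>

lemma Lam_lim:
  assumes n: "n \<ge> 1"
  obtains l where "l > 0" "(L n \<longlongrightarrow> l) at_top"
proof -
  obtain l where l: "l > 0" "(B2 n \<longlongrightarrow> l) at_top" using B2_lim[OF n] .
  have "(L n \<longlongrightarrow> l) at_top" unfolding Lam_def
    by (rule tendsto_eq_intros A1_lim B1_lim A2_lim l(2) | simp)+
  then show ?thesis using that l(1) by blast
qed

text \<open>The product \<open>C1 * B1\<close> dies out, so the numerator tends to minus the limit
  of \<open>D1\<close>, which is nonzero because \<open>n \<ge> 1\<close> and
  \<open>\<beta> n \<ge> 0\<close>.\<close>

lemma Xi1_lim:
  assumes n: "n \<ge> 1"
  obtains l where "l \<noteq> 0" "(X1 n \<longlongrightarrow> l) at_top"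
proof -
  obtain l where l: "l > 0" "(L n \<longlongrightarrow> l) at_top" using Lam_lim[OF n] .
  have lim: "(X1 n \<longlongrightarrow> - (real n + \<beta> n / a) / l) at_top" unfolding Xi1_def
    using l(1) by (auto intro!: tendsto_eq_intros A1_lim B1_lim C1_lim D1_lim l(2))
  have "real n + \<beta> n / a > 0"
    using n by (intro add_pos_nonneg divide_nonneg_pos \<beta>_nonneg a_pos) simp
  then have "- (real n + \<beta> n / a) / l \<noteq> 0" using l(1) by simp
  then show ?thesis using lim by (rule that)
qed

section \<open>Rationality of the coefficients and finiteness of the exceptional set\<close>

lemma rational_A1: "rational_on {x. (x - c) * (x - c - 1) \<noteq> 0} (A1 n)"
  unfolding coefA1_def[abs_def] by (intro rational_on_intros) auto

lemma rational_B1: "rational_on {x. (x - c) * (x - c - 1) \<noteq> 0} (B1 n)"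
  unfolding coefB1_def[abs_def] by (intro rational_on_intros) auto

lemma rational_coef_domain:
  "rational_on coef_domain (A1 n)" "rational_on coef_domain (B1 n)"
  "rational_on coef_domain (\<lambda>x. A1 n (x + 1))" "rational_on coef_domain (\<lambda>x. B1 n (x + 1))"
  by (rule rational_on_subset[OF rational_A1] rational_on_subset[OF rational_B1]
      rational_on_shift[OF rational_A1] rational_on_shift[OF rational_B1]; force simp: coef_domain_def)+

lemma rational_coefs:
  assumes n: "n \<ge> 1"
  shows "rational_on coef_domain (C1 n)" "rational_on coef_domain (D1 n)" "rational_on coef_domain (A2 n)"
    "rational_on coef_domain (B2 n)" "rational_on coef_domain (C2 n)" "rational_on coef_domain (D2 n)"
    "rational_on coef_domain (L n)"
proof -
  note intros = rational_on_intros rational_coef_domain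
  show "rational_on coef_domain (C1 n)" unfolding coefC1_def[abs_def]
    by (intro intros) (use a_pos in auto)
  show "rational_on coef_domain (D1 n)" unfolding coefD1_def[abs_def]
    by (intro intros) (use a_pos in auto)
  show A2: "rational_on coef_domain (A2 n)" unfolding coefA2_def[abs_def]
    by (intro intros) (use a_pos in auto)
  show B2: "rational_on coef_domain (B2 n)" unfolding coefB2_def[abs_def]
    by (intro intros) (use a_pos in auto)
  show "rational_on coef_domain (C2 n)" unfolding coefC2_def[abs_def]
    by (intro intros) (use a_pos in auto)
  show "rational_on coef_domain (D2 n)" unfolding coefD2_def[abs_def]
    by (intro intros) (use a_pos in auto)
  show "rational_on coef_domain (L n)" unfolding Lam_def[abs_def] by (intro intros A2 B2)
qed

definition structure_domain where "structure_domain n = {x \<in> coef_domain. L n x \<noteq> 0}"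

lemma rational_structure:
  assumes n: "n \<ge> 1"
  shows "rational_on (structure_domain n) (X1 n)" "rational_on (structure_domain n) (X2 n)"
    "rational_on (structure_domain n) (T1 n)" "rational_on (structure_domain n) (T2 n)"
proof -
  have sub: "structure_domain n \<subseteq> coef_domain" by (auto simp: structure_domain_def)
  note intros = rational_on_intros rational_coefs[OF n, THEN rational_on_subset[OF _ sub]]
    rational_coef_domain[THEN rational_on_subset[OF _ sub]]
  show "rational_on (structure_domain n) (X1 n)" unfolding Xi1_def[abs_def]
    by (intro intros) (simp add: structure_domain_def)
  show "rational_on (structure_domain n) (X2 n)" unfolding Xi2_def[abs_def]
    by (intro intros) (simp add: structure_domain_def)
  show "rational_on (structure_domain n) (T1 n)" unfolding Theta1_def[abs_def]
    by (intro intros) (simp add: structure_domain_def)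
  show "rational_on (structure_domain n) (T2 n)" unfolding Theta2_def[abs_def]
    by (intro intros) (simp add: structure_domain_def)
qed

lemma finite_compl_structure_domain:
  assumes n: "n \<ge> 1"
  shows "finite (- structure_domain n)"
proof -
  obtain l where "l > 0" "(L n \<longlongrightarrow> l) at_top" using Lam_lim[OF n] .
  then have "finite {x\<in>coef_domain. L n x = 0}"
    using rational_coefs(7)[OF n] finite_compl_coef_domain
    by (intro rational_on_finite_zeros) auto
  then have "finite (- coef_domain \<union> {x\<in>coef_domain. L n x = 0})" using finite_compl_coef_domain by simp
  then show ?thesis by (rule rev_finite_subset) (auto simp: structure_domain_def)
qed

abbreviation "Reg \<equiv> regular_points a lam c Q"

text \<open>Membership of \<open>x\<close> and \<open>x + 1\<close> in \<open>coef_domain\<close>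
  covers the pole conditions at \<open>x\<close>, \<open>x + 1\<close> and \<open>x + 2\<close>,
  with overlap at \<open>x + 1\<close>.\<close>

lemma regular_points_iff: "x \<in> Reg n \<longleftrightarrow> x \<in> structure_domain n \<and> x + 1 \<in> structure_domain n \<and> X1 n x \<noteq> 0"
  by (auto simp: regular_points_def structure_domain_def coef_domain_def add.assoc)

lemma finite_compl_regular_points:
  assumes n: "n \<ge> 1"
  shows "finite (- Reg n)"
proof -
  obtain l where "l \<noteq> 0" "(X1 n \<longlongrightarrow> l) at_top" using Xi1_lim[OF n] .
  then have "finite {x \<in> structure_domain n. X1 n x = 0}"
    using rational_structure(1)[OF n] finite_compl_structure_domain[OF n]
    by (intro rational_on_finite_zeros)
  moreover have "finite ((\<lambda>x. x - 1) ` (- structure_domain n))"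
    using finite_compl_structure_domain[OF n] by (rule finite_imageI)
  ultimately have "finite (- structure_domain n \<union> (\<lambda>x. x - 1) ` (- structure_domain n) \<union> {x \<in> structure_domain n. X1 n x = 0})"
    using finite_compl_structure_domain[OF n] by simp
  then show ?thesis
    by (rule rev_finite_subset) (force simp: regular_points_iff image_iff)
qed

lemma rational_coefR_coefS:
  assumes n: "n \<ge> 1"
  shows "rational_on (Reg n) (coefR a lam c Q n)" "rational_on (Reg n) (coefS a lam c Q n)"
proof -
  \<comment> \<open>Shifted values are included because \<open>coefR\<close> and
    \<open>coefS\<close> contain differences of \<open>X1\<close> and \<open>X2\<close>.\<close>
  have "rational_on (Reg n) f \<and> rational_on (Reg n) (\<lambda>x. f (x + 1))"
    if "rational_on (structure_domain n) f" for f
    by (intro conjI rational_on_subset[OF that] rational_on_shift[OF that])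
      (auto simp: regular_points_iff)
  note intros = rational_on_intros rational_structure[OF n, THEN this, THEN conjunct1]
    rational_structure[OF n, THEN this, THEN conjunct2]
  show "rational_on (Reg n) (coefR a lam c Q n)"
    unfolding coefR_def[abs_def] Delta_def
    by (intro intros) (simp add: regular_points_iff)
  show "rational_on (Reg n) (coefS a lam c Q n)"
    unfolding coefS_def[abs_def] Delta_def
    by (intro intros) (simp add: regular_points_iff)
qed

end

text \<open>Cofiniteness of the regular points keeps the pointwise equation and the rationality
  claims from being vacuous.\<close>

theorem theorem3:
  fixes a lam c :: real and n :: nat and Q :: "nat \<Rightarrow> real poly"
  assumes "a > 0" and "lam \<ge> 0" and "n \<ge> 1"
    and "\<forall>k::nat. real k \<notin> {c<..<c + 1}"
    and "sobolev_charlier a lam c Q"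
  shows "finite (- regular_points a lam c Q n) \<and>
    rational_on (regular_points a lam c Q n) (coefR a lam c Q n) \<and>
    rational_on (regular_points a lam c Q n) (coefS a lam c Q n) \<and>
    (\<forall>x\<in>regular_points a lam c Q n.
       Delta (Delta (poly (Q n))) x + coefR a lam c Q n x * Delta (poly (Q n)) x
         + coefS a lam c Q n x * poly (Q n) x = 0)"
proof -
  interpret charlier_sobolev a lam c Q
    by unfold_locales (fact assms)+
  show ?thesis
    using finite_compl_regular_points rational_coefR_coefS difference_equation \<open>n \<ge> 1\<close> by blast
qed

end
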